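(* Let $F,G\subset[0,1]$ be the Cantor-like sets constructed in the context. Then $\dim_{LB}(F\times G)>\dim_{LB}(F)+\dim_{LB}(G)$.
   Context: Box-counting dimensions: for a compact set $A$ in a metric space and $\delta>0$, $N(A,\delta)$ is the smallest number of sets of diameter at most $\delta$ that form a cover of $A$. The lower box-counting dimension is $\dim_{LB}(A)=\liminf_{\delta\searrow 0}\frac{\log N(A,\delta)}{-\log\delta}$. The product $F\times G\subset\mathbb{R}^2$ carries the Euclidean metric. Construction of $F$ and $G$: let $\mathbb{N}=\{0,1,2,\dots\}$ and $K_j=10^{2^j}$ for $j\in\mathbb{N}$. For $k\in\{3,5,7\}$ the generator $\mathrm{gen}_k$ acts on a finite disjoint union of closed intervals by removing from each interval its open middle part of proportion $\frac{k-2}{k}$, i.e. it replaces each interval $[a,b]$ by the two intervals $[a,a+\frac{b-a}{k}]$ and $[b-\frac{b-a}{k},b]$. Put $F_0=G_0=[0,1]$. For $j\ge 1$, $F_j$ is obtained from $F_{j-1}$ by applying (at stage $j$) $\mathrm{gen}_3$ if $K_{6n}<j\le K_{6n+1}$ for some $n\in\mathbb{N}$, $\mathrm{gen}_7$ if $K_{6n+1}<j\le K_{6n+2}$ for some $n\in\mathbb{N}$, and $\mathrm{gen}_5$ otherwise. For $j\ge1$, $G_j$ is obtained from $G_{j-1}$ by applying $\mathrm{gen}_3$ if $K_{6m+3}<j\le K_{6m+4}$ for some $m\in\mathbb{N}$, $\mathrm{gen}_7$ if $K_{6m+4}<j\le K_{6m+5}$ for some $m\in\mathbb{N}$, and $\mathrm{gen}_5$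 otherwise. Finally $F=\bigcap_{j\ge0}F_j$ and $G=\bigcap_{j\ge0}G_j$. *)

theory Defs
  imports "HOL-Analysis.Analysis"
begin

text \<open>
  The library's \<open>diameter\<close> is the supremum of the pairwise distances taken in the reals, which
  carries no information for an unbounded set; hence the explicit boundedness condition.
  For compact \<open>A\<close> and \<open>\<delta> > 0\<close> the set of admissible \<open>n\<close> is nonempty.
\<close>

definition covering_number :: "'a::metric_space set \<Rightarrow> real \<Rightarrow> nat" where
  "covering_number A \<delta> =
     (LEAST n. \<exists>\<C>. finite \<C> \<and> card \<C> = n \<and> A \<subseteq> \<Union>\<C> \<and>
        (\<forall>U\<in>\<C>. bounded U \<and> diameter U \<le> \<delta>))"

text \<open>The lower limit is taken in the extended reals, where it always exists.\<close>

definition lower_box_dim :: "'a::metric_space set \<Rightarrow> ereal" where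
  "lower_box_dim A =
     Liminf (at_right 0) (\<lambda>\<delta>. ereal (ln (real (covering_number A \<delta>)) / (- ln \<delta>)))"

text \<open>
  A finite disjoint union of closed intervals is encoded by the set of the endpoint pairs
  \<open>(a, b)\<close> of its intervals \<open>[a, b]\<close>.
\<close>

definition gen :: "nat \<Rightarrow> (real \<times> real) set \<Rightarrow> (real \<times> real) set" where
  "gen k I = (\<Union>(a, b)\<in>I. {(a, a + (b - a) / real k), (b - (b - a) / real k, b)})"

text \<open>The argument \<open>k\<close> gives the generator \<open>gen (k j)\<close> used at stage \<open>j \<ge> 1\<close>; \<open>k 0\<close> is not used.\<close>

primrec stage_intervals :: "(nat \<Rightarrow> nat) \<Rightarrow> nat \<Rightarrow> (real \<times> real) set" where
  "stage_intervals k 0 = {(0, 1)}"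
| "stage_intervals k (Suc j) = gen (k (Suc j)) (stage_intervals k j)"

definition stage :: "(nat \<Rightarrow> nat) \<Rightarrow> nat \<Rightarrow> real set" where
  "stage k j = (\<Union>(a, b)\<in>stage_intervals k j. {a..b})"

definition cantor_like :: "(nat \<Rightarrow> nat) \<Rightarrow> real set" where
  "cantor_like k = (\<Inter>j. stage k j)"

definition K :: "nat \<Rightarrow> nat" where
  "K j = 10 ^ (2 ^ j)"

definition gen_index_F :: "nat \<Rightarrow> nat" where
  "gen_index_F j =
     (if \<exists>n. K (6 * n) < j \<and> j \<le> K (6 * n + 1) then 3
      else if \<exists>n. K (6 * n + 1) < j \<and> j \<le> K (6 * n + 2) then 7
      else 5)"

definition gen_index_G :: "nat \<Rightarrow> nat" where
  "gen_index_G j =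
     (if \<exists>m. K (6 * m + 3) < j \<and> j \<le> K (6 * m + 4) then 3
      else if \<exists>m. K (6 * m + 4) < j \<and> j \<le> K (6 * m + 5) then 7
      else 5)"

definition F_set :: "real set" where
  "F_set = cantor_like gen_index_F"

definition G_set :: "real set" where
  "G_set = cantor_like gen_index_G"

end

theory Submission
  imports Defs
begin

text \<open>
  At stage \<open>j\<close> a Cantor-like set consists of \<open>2 ^ j\<close> intervals whose length is the reciprocal of
  the product of the first \<open>j\<close> generator indices. Because \<open>K (i + 1)\<close> is the square of \<open>K i\<close>, a
  block of stages from \<open>K i\<close> to \<open>K (i + 1)\<close> dwarfs everything before it. At the end of a block of
  \<open>gen 7\<close> nearly all generators so far were \<open>gen 7\<close>, so at those scales the set looks like one
  of dimension about \<open>d = ln 2 / ln 7\<close>. Each of \<open>F\<close> and \<open>G\<close> has infinitely many such blocks,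
  and the lower dimensions of both are at most \<open>100 / 99 * d\<close>
  (\<open>lower_box_dim_shifted_le\<close>); the error of one percent comes from \<open>K 1 = 100\<close>.

  The \<open>gen 7\<close> blocks of \<open>F\<close> and \<open>G\<close> never overlap, and their effect on the averages has faded by
  the time the other set enters its own such block. Consequently at every small scale
  \<open>\<delta> \<approx> 7 ^ (- m)\<close> one of the two sets has had at least nine tenths of its first \<open>m\<close> generators
  of index 3 or 5 (\<open>F_or_G_gains\<close>). That set reaches stage \<open>m + 3 / 20 * m\<close> before its
  intervals become shorter than \<open>\<delta>\<close> (\<open>shifted_stage_length_ge_gain\<close>), whereas the other
  reaches at least stage \<open>m\<close>. The left ends of the intervals are well separated, so covering the
  product requires about \<open>2 ^ (m + m + 3 / 20 * m)\<close> sets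
  (\<open>covering_number_Times_cantor_like_ge\<close>), and its lower dimension is at least
  \<open>21 / 10 * d\<close>. This exceeds \<open>200 / 99 * d\<close>.
\<close>

section \<open>Covering numbers\<close>

lemma covering_number_le_card:
  assumes "finite \<C>" "A \<subseteq> \<Union>\<C>" "\<And>U. U \<in> \<C> \<Longrightarrow> bounded U \<and> diameter U \<le> \<delta>"
  shows "covering_number A \<delta> \<le> card \<C>"
  unfolding covering_number_def by (rule Least_le) (use assms in blast)

lemma covering_number_attained:
  fixes A :: "'a::metric_space set"
  assumes "A \<subseteq> C" "compact C" "\<delta> > 0"
  obtains \<C> where "finite \<C>" "card \<C> = covering_number A \<delta>" "A \<subseteq> \<Union>\<C>"
    "\<And>U. U \<in> \<C> \<Longrightarrow> bounded U \<and> diameter U \<le> \<delta>"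
proof -
  obtain S where S: "finite S" "C \<subseteq> (\<Union>x\<in>S. ball x (\<delta>/2))"
    using assms(2,3) compact_imp_seq_compact seq_compact_imp_totally_bounded
    by (metis half_gt_zero)
  let ?\<B> = "(\<lambda>x. ball x (\<delta>/2)) ` S"
  have "dist y z \<le> \<delta>" if "y \<in> ball x (\<delta>/2)" "z \<in> ball x (\<delta>/2)" for x y z :: 'a
    using that dist_triangle3[of y z x] by (simp add: dist_commute)
  then have "diameter (ball x (\<delta>/2)) \<le> \<delta>" for x :: 'a
    using \<open>\<delta> > 0\<close> unfolding diameter_def by (auto intro!: cSUP_least)
  then have "\<exists>n \<C>. finite \<C> \<and> card \<C> = n \<and> A \<subseteq> \<Union>\<C> \<and>
      (\<forall>U\<in>\<C>. bounded U \<and> diameter U \<le> \<delta>)"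
    using S assms(1) by (intro exI[of _ "card ?\<B>"] exI[of _ ?\<B>]) auto
  from LeastI_ex[OF this] show ?thesis
    using that unfolding covering_number_def by blast
qed

text \<open>A set of diameter at most \<open>\<delta>\<close> contains at most one point of a set whose points are more
  than \<open>\<delta>\<close> apart. Compactness guarantees that a finite cover exists at all, without which the
  least number in the definition of \<open>covering_number\<close> would be arbitrary.\<close>

lemma card_separated_le_covering_number:
  fixes A :: "'a::metric_space set"
  assumes "A \<subseteq> C" "compact C" "\<delta> > 0" and "P \<subseteq> A"
    and sep: "\<And>x y. x \<in> P \<Longrightarrow> y \<in> P \<Longrightarrow> x \<noteq> y \<Longrightarrow> dist x y > \<delta>"
  shows "card P \<le> covering_number A \<delta>"
proof -
  obtain \<C> where \<C>: "finite \<C>" "card \<C> = covering_number A \<delta>" "A \<subseteq> \<Union>\<C>"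
    "\<And>U. U \<in> \<C> \<Longrightarrow> bounded U \<and> diameter U \<le> \<delta>"
    using covering_number_attained[OF assms(1-3)] by metis
  have "\<forall>x\<in>P. \<exists>U\<in>\<C>. x \<in> U" using \<C>(3) \<open>P \<subseteq> A\<close> by blast
  then obtain f where f: "\<And>x. x \<in> P \<Longrightarrow> f x \<in> \<C> \<and> x \<in> f x" by metis
  have "inj_on f P"
  proof (rule inj_onI, rule ccontr)
    fix x y assume xy: "x \<in> P" "y \<in> P" "f x = f y" "x \<noteq> y"
    have "dist x y \<le> diameter (f x)"
      using xy f \<C>(4) by (metis diameter_bounded_bound)
    then show False using sep[of x y] xy f \<C>(4) by fastforce
  qed
  then have "card P \<le> card \<C>"
    using f \<C>(1) by (intro card_inj_on_le[of f]) auto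
  then show ?thesis using \<C>(2) by simp
qed

section \<open>The intervals of the construction\<close>

definition stage_length :: "(nat \<Rightarrow> nat) \<Rightarrow> nat \<Rightarrow> real" where
  "stage_length k j = (\<Prod>i=1..j. 1 / real (k i))"

text \<open>All intervals of a stage have the same length, so their left ends determine them. The left
  ends of a stage remain left ends at every later stage.\<close>

primrec left_ends :: "(nat \<Rightarrow> nat) \<Rightarrow> nat \<Rightarrow> real set" where
  "left_ends k 0 = {0}"
| "left_ends k (Suc j) =
     left_ends k j \<union> (\<lambda>a. a + (stage_length k j - stage_length k (Suc j))) ` left_ends k j"

lemma stage_length_0 [simp]: "stage_length k 0 = 1"
  by (simp add: stage_length_def)

lemma stage_length_Suc: "stage_length k (Suc j) = stage_length k j / real (k (Suc j))"
  by (simp add: stage_length_def)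

lemma stage_length_pos:
  assumes "\<And>i. 3 \<le> k i"
  shows "0 < stage_length k j"
proof -
  have "0 < k i" for i using assms[of i] by simp
  then show ?thesis unfolding stage_length_def by (intro prod_pos) simp
qed

lemma stage_length_3:
  assumes "\<And>i. 3 \<le> k i"
  shows "3 * stage_length k (Suc j) \<le> stage_length k j"
proof -
  have "3 \<le> real (k (Suc j))" using assms[of "Suc j"] by simp
  moreover have "0 < stage_length k j" by (rule stage_length_pos[of k, OF assms])
  ultimately show ?thesis by (simp add: stage_length_Suc field_simps)
qed

lemma ln_stage_length:
  assumes "\<And>i. 3 \<le> k i"
  shows "- ln (stage_length k j) = (\<Sum>i=1..j. ln (real (k i)))"
proof -
  have "0 < k i" for i using assms[of i] by simp
  then show ?thesis
    by (simp add: stage_length_def ln_prod ln_div sum_negf)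
qed

lemma stage_intervals_eq:
  "stage_intervals k j = (\<lambda>a. (a, a + stage_length k j)) ` left_ends k j"
proof (induction j)
  case (Suc j)
  then show ?case
    by (auto simp: gen_def stage_length_Suc image_Un image_image algebra_simps)
qed simp

lemma stage_eq: "stage k j = (\<Union>a\<in>left_ends k j. {a..a + stage_length k j})"
  by (simp add: stage_def stage_intervals_eq)

lemma stage_Suc_subset:
  assumes "\<And>i. 3 \<le> k i"
  shows "stage k (Suc j) \<subseteq> stage k j"
proof
  fix x assume "x \<in> stage k (Suc j)"
  then obtain a where a: "a \<in> left_ends k (Suc j)" "a \<le> x" "x \<le> a + stage_length k (Suc j)"
    unfolding stage_eq UN_iff atLeastAtMost_iff by blast
  then obtain b where "b \<in> left_ends k j"
    "a = b \<or> a = b + (stage_length k j - stage_length k (Suc j))"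
    by auto
  moreover have "0 < stage_length k (Suc j)" "3 * stage_length k (Suc j) \<le> stage_length k j"
    using stage_length_pos stage_length_3 assms by blast+
  ultimately show "x \<in> stage k j" using a unfolding stage_eq by (auto intro!: bexI[of _ b])
qed

lemma finite_left_ends: "finite (left_ends k j)"
  by (induction j) auto

lemma card_left_ends_le: "card (left_ends k j) \<le> 2 ^ j"
proof (induction j)
  case (Suc j)
  have "card (left_ends k (Suc j)) \<le> card (left_ends k j) + card (left_ends k j)"
    unfolding left_ends.simps
    by (rule order.trans[OF card_Un_le]) (simp add: card_image_le finite_left_ends)
  then show ?case using Suc by simp
qed simp

text \<open>Siblings at stage \<open>j + 1\<close> start \<open>k - 1 \<ge> 2\<close> lengths apart. Cousins have parents that start
  two parental lengths apart, and each child starts less than one parental length to the right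
  of its parent.\<close>

lemma left_ends_separated:
  assumes "\<And>i. 3 \<le> k i" "a \<in> left_ends k j" "b \<in> left_ends k j" "a \<noteq> b"
  shows "2 * stage_length k j \<le> \<bar>a - b\<bar>"
  using assms(2-)
proof (induction j arbitrary: a b)
  case (Suc j)
  let ?L = "stage_length k j" and ?l = "stage_length k (Suc j)"
  have l: "0 < ?l" "3 * ?l \<le> ?L"
    using stage_length_pos stage_length_3 assms(1) by blast+
  obtain a' s where a: "a' \<in> left_ends k j" "a = a' + s" "s = 0 \<or> s = ?L - ?l"
    using Suc.prems(1) by fastforce
  obtain b' t where b: "b' \<in> left_ends k j" "b = b' + t" "t = 0 \<or> t = ?L - ?l"
    using Suc.prems(2) by fastforce
  show ?case
  proof (cases "a' = b'")
    case True
    then show ?thesis using a b l Suc.prems(3) by auto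
  next
    case False
    then have "2 * ?L \<le> \<bar>a' - b'\<bar>" using Suc.IH a b by blast
    then show ?thesis using a b l by auto
  qed
qed simp

lemma card_left_ends:
  assumes "\<And>i. 3 \<le> k i"
  shows "card (left_ends k j) = 2 ^ j"
proof (induction j)
  case (Suc j)
  let ?L = "stage_length k j" and ?l = "stage_length k (Suc j)"
  let ?B = "(\<lambda>a. a + (?L - ?l)) ` left_ends k j"
  have l: "0 < ?l" "3 * ?l \<le> ?L"
    using stage_length_pos stage_length_3 assms by blast+
  have "False" if "a \<in> left_ends k j" "a + (?L - ?l) \<in> left_ends k j" for a
    using left_ends_separated[of k, OF assms that] l by simp
  then have "left_ends k j \<inter> ?B = {}" by blast
  moreover have "card ?B = card (left_ends k j)"
    by (intro card_image) (simp add: inj_on_def)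
  ultimately show ?case
    using Suc by (simp add: card_Un_disjoint finite_left_ends)
qed simp

lemma left_ends_subset_cantor_like:
  assumes "\<And>i. 3 \<le> k i"
  shows "left_ends k j \<subseteq> cantor_like k"
proof -
  have sub: "left_ends k i \<subseteq> stage k i" for i
    using stage_length_pos[of k i, OF assms] by (force simp: stage_eq)
  have "left_ends k j \<subseteq> stage k i" for i
  proof (cases "i \<le> j")
    case True
    then have "stage k j \<subseteq> stage k i"
      by (rule lift_Suc_antimono_le[of "stage k", rotated]) (rule stage_Suc_subset[of k, OF assms])
    then show ?thesis using sub by blast
  next
    case False
    then have "j \<le> i" by simp
    then have "left_ends k j \<subseteq> left_ends k i"
      by (rule lift_Suc_mono_le[of "left_ends k", rotated]) auto
    then show ?thesis using sub by blast
  qed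
  then show ?thesis by (auto simp: cantor_like_def)
qed

lemma cantor_like_subset_unit: "cantor_like k \<subseteq> {0..1}"
proof -
  have "stage k 0 = {0..1}" by (simp add: stage_eq)
  then show ?thesis unfolding cantor_like_def by blast
qed

section \<open>Box dimensions of Cantor-like sets\<close>

lemma covering_number_cantor_like_le:
  assumes "\<And>i. 3 \<le> k i"
  shows "covering_number (cantor_like k) (stage_length k j) \<le> 2 ^ j"
proof -
  let ?\<C> = "(\<lambda>a. {a..a + stage_length k j}) ` left_ends k j"
  have "covering_number (cantor_like k) (stage_length k j) \<le> card ?\<C>"
    using stage_length_pos[of k j, OF assms]
    by (intro covering_number_le_card)
       (auto simp: finite_left_ends cantor_like_def stage_eq)
  also have "\<dots> \<le> card (left_ends k j)"
    by (rule card_image_le[OF finite_left_ends])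
  also have "\<dots> \<le> 2 ^ j" by (rule card_left_ends_le)
  finally show ?thesis .
qed

text \<open>The left ends of the intervals stay in the limit set, so the pairs of left ends are points
  of the product. They are more than \<open>\<delta>\<close> apart in one coordinate.\<close>

lemma covering_number_Times_cantor_like_ge:
  assumes k: "\<And>i. 3 \<le> k i" and h: "\<And>i. 3 \<le> h i" and "0 < \<delta>"
    and a: "\<delta> \<le> stage_length k a" and b: "\<delta> \<le> stage_length h b"
  shows "2 ^ (a + b) \<le> covering_number (cantor_like k \<times> cantor_like h) \<delta>"
proof -
  let ?P = "left_ends k a \<times> left_ends h b"
  have "card ?P \<le> covering_number (cantor_like k \<times> cantor_like h) \<delta>"
  proof (rule card_separated_le_covering_number)
    show "cantor_like k \<times> cantor_like h \<subseteq> {0..1} \<times> {0..1}"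
      using cantor_like_subset_unit by blast
    show "compact ({0..1::real} \<times> {0..1::real})" by (intro compact_Times) auto
    show "?P \<subseteq> cantor_like k \<times> cantor_like h"
      using left_ends_subset_cantor_like[of k, OF k] left_ends_subset_cantor_like[of h, OF h] by blast
    fix p q assume p: "p \<in> ?P" and q: "q \<in> ?P" and "p \<noteq> q"
    then consider "fst p \<noteq> fst q" | "snd p \<noteq> snd q" by (meson prod_eqI)
    then show "\<delta> < dist p q"
    proof cases
      case 1
      then have "2 * stage_length k a \<le> dist (fst p) (fst q)"
        using left_ends_separated[of k, OF k] p q by (auto simp: dist_real_def)
      then show ?thesis using dist_fst_le[of p q] a \<open>0 < \<delta>\<close> by linarith
    next
      case 2
      then have "2 * stage_length h b \<le> dist (snd p) (snd q)"
        using left_ends_separated[of h, OF h] p q by (auto simp: dist_real_def)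
      then show ?thesis using dist_snd_le[of p q] b \<open>0 < \<delta>\<close> by linarith
    qed
  qed fact
  then show ?thesis
    by (simp add: card_cartesian_product card_left_ends[of k, OF k] card_left_ends[of h, OF h] power_add)
qed

text \<open>Infinitely many good scales bound a lower limit from above, and the stage lengths supply
  such scales.\<close>

lemma lower_box_dim_cantor_like_le:
  assumes k: "\<And>i. 3 \<le> k i"
    and freq: "\<And>N. \<exists>j\<ge>N. real j * ln 2 \<le> q * (\<Sum>i=1..j. ln (real (k i)))"
  shows "lower_box_dim (cantor_like k) \<le> ereal q"
proof (rule ccontr)
  let ?r = "\<lambda>\<delta>. ln (real (covering_number (cantor_like k) \<delta>)) / (- ln \<delta>)"
  assume "\<not> ?thesis"
  then have "ereal q < Liminf (at_right 0) (\<lambda>\<delta>. ereal (?r \<delta>))"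
    by (simp add: lower_box_dim_def)
  then have "\<forall>\<^sub>F \<delta> in at_right 0. q < ?r \<delta>"
    by (auto dest!: less_LiminfD)
  then obtain e where e: "e > 0" "\<And>\<delta>. 0 < \<delta> \<Longrightarrow> \<delta> < e \<Longrightarrow> q < ?r \<delta>"
    by (auto simp: eventually_at_right_field)
  obtain N where N: "(1/3::real) ^ N < e"
    using real_arch_pow_inv[of e "1/3"] e(1) by auto
  obtain j where j: "j \<ge> Suc N" "real j * ln 2 \<le> q * (\<Sum>i=1..j. ln (real (k i)))"
    using freq by blast
  let ?\<delta> = "stage_length k j"
  have pos: "0 < ?\<delta>" by (rule stage_length_pos[of k, OF k])
  have small: "stage_length k i \<le> (1/3) ^ i" for i
  proof (induction i)
    case (Suc i)
    then show ?case using stage_length_3[of k i, OF k] by simp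
  qed simp
  have "(1/3::real) ^ j \<le> (1/3) ^ N" using j(1) by (intro power_decreasing) auto
  then have "?\<delta> < e" using small[of j] N by linarith
  then have r: "q < ?r ?\<delta>" using e(2) pos by blast
  have "(1/3::real) ^ j < 1" using j(1) by (simp add: power_less_one_iff)
  then have "0 < - ln ?\<delta>" using small[of j] pos by (simp add: ln_less_zero)
  then have "q * (- ln ?\<delta>) < ln (real (covering_number (cantor_like k) ?\<delta>))"
    using r by (simp add: field_simps)
  also have "\<dots> \<le> real j * ln 2"
    \<comment> \<open>The case distinction accounts for the value \<open>ln 0 = 0\<close>.\<close>
  proof (cases "covering_number (cantor_like k) ?\<delta> = 0")
    case False
    have "real (covering_number (cantor_like k) ?\<delta>) \<le> 2 ^ j"
      using covering_number_cantor_like_le[of k j, OF k]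
      by (metis of_nat_le_iff of_nat_numeral of_nat_power)
    then have "ln (real (covering_number (cantor_like k) ?\<delta>)) \<le> ln (2 ^ j)"
      using False by (subst ln_le_cancel_iff) auto
    then show ?thesis by (simp add: ln_realpow)
  qed simp
  also have "\<dots> \<le> q * (- ln ?\<delta>)" using j(2) ln_stage_length[of k, OF k] by simp
  finally show False by simp
qed

section \<open>The shared generator pattern\<close>

text \<open>The pattern of \<open>G\<close> is that of \<open>F\<close> with each breakpoint \<open>K i\<close> moved to \<open>K (i + 3)\<close>, half of the
  period 6.\<close>

definition shifted_index :: "nat \<Rightarrow> nat \<Rightarrow> nat" where
  "shifted_index s j =
     (if \<exists>n. K (6 * n + s) < j \<and> j \<le> K (6 * n + s + 1) then 3
      else if \<exists>n. K (6 * n + s + 1) < j \<and> j \<le> K (6 * n + s + 2) then 7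
      else 5)"

lemma gen_index_F_eq: "gen_index_F = shifted_index 0"
  by (simp add: fun_eq_iff gen_index_F_def shifted_index_def)

lemma gen_index_G_eq: "gen_index_G = shifted_index 3"
proof -
  have "6 * n + 3 + 1 = 6 * n + 4" "6 * n + 3 + 2 = 6 * n + 5" for n :: nat by simp_all
  then show ?thesis by (simp only: fun_eq_iff gen_index_G_def shifted_index_def) simp
qed

lemma shifted_index_bounds: "3 \<le> shifted_index s j" "shifted_index s j \<le> 7"
  by (auto simp: shifted_index_def)

lemma K_less_iff [simp]: "K i < K j \<longleftrightarrow> i < j"
  by (simp add: K_def)

lemma K_le_iff [simp]: "K i \<le> K j \<longleftrightarrow> i \<le> j"
  by (simp add: K_def)

lemma K_Suc: "K (Suc i) = K i * K i"
  by (simp add: K_def mult_2 power_add)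

lemma K_ge_10: "10 \<le> K i"
  using K_le_iff[of 0 i] by (simp add: K_def)

lemma shifted_index_eq_7:
  assumes "K (6 * n + s + 1) < j" "j \<le> K (6 * n + s + 2)"
  shows "shifted_index s j = 7"
proof -
  have False if "K (6 * n' + s) < j" "j \<le> K (6 * n' + s + 1)" for n'
  proof -
    have "K (6 * n + s + 1) < K (6 * n' + s + 1)" "K (6 * n' + s) < K (6 * n + s + 2)"
      using assms that by linarith+
    then show False by simp
  qed
  then show ?thesis using assms unfolding shifted_index_def by auto
qed

lemma shifted_index_le_5:
  assumes "K (6 * n + s + 2) < j" "j \<le> K (6 * n + s + 7)"
  shows "shifted_index s j \<le> 5"
proof -
  have False if "K (6 * n' + s + 1) < j" "j \<le> K (6 * n' + s + 2)" for n'
  proof -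
    have "K (6 * n + s + 2) < K (6 * n' + s + 2)" "K (6 * n' + s + 1) < K (6 * n + s + 7)"
      using assms that by linarith+
    then show False by simp
  qed
  then show ?thesis unfolding shifted_index_def by auto
qed

text \<open>At stage \<open>j = K (6 * n + s + 2)\<close> all but the first \<open>sqrt j \<le> j / 100\<close> generators are
  \<open>gen 7\<close>.\<close>

lemma lower_box_dim_shifted_le:
  "lower_box_dim (cantor_like (shifted_index s)) \<le> ereal (100 / 99 * (ln 2 / ln 7))"
proof (rule lower_box_dim_cantor_like_le)
  fix N
  let ?k = "shifted_index s"
  define M where "M = K (6 * N + s + 1)"
  define j where "j = K (6 * N + s + 2)"
  have "K 1 \<le> M" unfolding M_def by simp
  then have M: "100 \<le> M" by (simp add: K_def)
  have jM: "j = M * M" using K_Suc[of "6 * N + s + 1"] by (simp add: j_def M_def)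
  then have "100 * M \<le> j" using M by simp
  have split: "{1..j} = {1..M} \<union> {M<..j}" using \<open>100 * M \<le> j\<close> by auto
  have "N < 10 ^ N" by (rule less_exp[THEN less_le_trans]) (simp add: power_mono)
  also have "\<dots> \<le> 10 ^ (2 ^ (6 * N + s + 2))"
  proof (rule power_increasing)
    have "N < 2 ^ N" by simp
    also have "(2::nat) ^ N \<le> 2 ^ (6 * N + s + 2)" by (rule power_increasing) auto
    finally show "N \<le> 2 ^ (6 * N + s + 2)" by simp
  qed simp
  finally have "N \<le> j" by (simp add: j_def K_def)
  have "real j * 99 \<le> 100 * real (j - M)" using \<open>100 * M \<le> j\<close> by linarith
  then have "real j * 99 * ln 7 \<le> 100 * real (j - M) * ln 7"
    by (intro mult_right_mono) auto
  also have "\<dots> = 100 * (\<Sum>i\<in>{M<..j}. ln (real (?k i)))"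
    by (simp add: shifted_index_eq_7[of N s] M_def j_def)
  also have "\<dots> \<le> 100 * (\<Sum>i=1..j. ln (real (?k i)))"
  proof -
    have "0 \<le> ln (real (?k i))" for i
      using shifted_index_bounds(1)[of s i] by simp
    then have "(\<Sum>i\<in>{M<..j}. ln (real (?k i))) \<le> (\<Sum>i=1..j. ln (real (?k i)))"
      by (intro sum_mono2) auto
    then show ?thesis by simp
  qed
  finally have "real j \<le> 100 / 99 * (1 / ln 7) * (\<Sum>i=1..j. ln (real (?k i)))"
    by (simp add: field_simps)
  then have "real j * ln 2 \<le> 100 / 99 * (1 / ln 7) * (\<Sum>i=1..j. ln (real (?k i))) * ln 2"
    by (intro mult_right_mono) auto
  then show "\<exists>j\<ge>N. real j * ln 2 \<le> 100 / 99 * (ln 2 / ln 7) * (\<Sum>i=1..j. ln (real (?k i)))"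
    using \<open>N \<le> j\<close> by (intro exI[of _ j]) (simp add: field_simps)
qed (rule shifted_index_bounds)

section \<open>The product\<close>

lemma stage_length_ge_exp:
  assumes "(\<Sum>i=1..j. ln (real (shifted_index s i))) \<le> x"
  shows "exp (- x) \<le> stage_length (shifted_index s) j"
proof -
  have "- x \<le> ln (stage_length (shifted_index s) j)"
    using assms ln_stage_length[of "shifted_index s" j, OF shifted_index_bounds(1)] by linarith
  then show ?thesis
    using stage_length_pos[of "shifted_index s" j, OF shifted_index_bounds(1)] by (simp add: ln_ge_iff)
qed

lemma ln_shifted_index_le: "ln (real (shifted_index s i)) \<le> ln 7"
  using shifted_index_bounds[of s i] by simp

lemma shifted_stage_length_ge:
  "exp (- (real m * ln 7)) \<le> stage_length (shifted_index s) m"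
proof (rule stage_length_ge_exp)
  show "(\<Sum>i=1..m. ln (real (shifted_index s i))) \<le> real m * ln 7"
    using sum_bounded_above[of "{1..m}" "\<lambda>i. ln (real (shifted_index s i))" "ln 7"]
      ln_shifted_index_le by simp
qed

lemma ln_5_le: "ln 5 \<le> 5 / 6 * ln (7::real)"
proof -
  \<comment> \<open>\<open>5 ^ 6 = 15625 \<le> 16807 = 7 ^ 5\<close>\<close>
  have "6 * ln 5 = ln (5 ^ 6 :: real)" by (subst ln_realpow) auto
  also have "\<dots> \<le> ln (7 ^ 5 :: real)" by (subst ln_le_cancel_iff) auto
  also have "\<dots> = 5 * ln 7" by (subst ln_realpow) auto
  finally show ?thesis by simp
qed

text \<open>Every generator costs at most \<open>ln 7\<close> in the logarithm of the length. Among the first \<open>m\<close>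
  generators, those after \<open>K (6 * n + s + 2) \<le> m / 10\<close> are \<open>gen 3\<close> or
  \<open>gen 5\<close> and cost at most \<open>5 / 6\<close> of \<open>ln 7\<close> each. The total is at most
  \<open>(1 / 10 + 9 / 10 * 5 / 6) * m * ln 7 = 17 / 20 * m * ln 7\<close>, which leaves room for
  \<open>3 / 20 * m\<close> further generators of whatever kind.\<close>

lemma shifted_stage_length_ge_gain:
  assumes "K (6 * n + s + 3) \<le> m" "m \<le> K (6 * n + s + 7)"
  shows "exp (- (real m * ln 7)) \<le> stage_length (shifted_index s) (m + 3 * m div 20)"
proof (rule stage_length_ge_exp)
  let ?f = "\<lambda>i. ln (real (shifted_index s i))"
  define M where "M = K (6 * n + s + 2)"
  define r where "r = 3 * m div 20"
  have "10 * M \<le> M * M" using K_ge_10 by (simp add: M_def)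
  also have "\<dots> \<le> m" 
    using K_Suc[of "6 * n + s + 2"] assms(1) by (simp add: M_def eval_nat_numeral)
  finally have M: "10 * M \<le> m" .
  have "{1..m + r} = {1..m} \<union> {m<..m + r}" "{1..m} = {1..M} \<union> {M<..m}" using M by auto
  moreover have "{1..m} \<inter> {m<..m + r} = {}" "{1..M} \<inter> {M<..m} = {}" by auto
  ultimately have "sum ?f {1..m + r} = sum ?f {1..M} + sum ?f {M<..m} + sum ?f {m<..m + r}"
    by (metis sum.union_disjoint finite_atLeastAtMost finite_greaterThanAtMost)
  also have "\<dots> \<le> real M * ln 7 + real (m - M) * (5 / 6 * ln 7) + real r * ln 7"
  proof (intro add_mono)
    show "sum ?f {1..M} \<le> real M * ln 7"
      using sum_bounded_above[of "{1..M}" ?f "ln 7"] ln_shifted_index_le by simp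
    show "sum ?f {m<..m + r} \<le> real r * ln 7"
      using sum_bounded_above[of "{m<..m + r}" ?f "ln 7"] ln_shifted_index_le by simp
    have "?f i \<le> 5 / 6 * ln 7" if "i \<in> {M<..m}" for i
    proof -
      have "shifted_index s i \<le> 5"
        using that assms by (intro shifted_index_le_5[of n]) (auto simp: M_def)
      then have "?f i \<le> ln 5" using shifted_index_bounds(1)[of s i] by simp
      then show ?thesis using ln_5_le by linarith
    qed
    then show "sum ?f {M<..m} \<le> real (m - M) * (5 / 6 * ln 7)"
      using sum_bounded_above[of "{M<..m}" ?f "5 / 6 * ln 7"] by simp
  qed
  also have "\<dots> = (real M + real (m - M) * (5 / 6) + real r) * ln 7"
    by (simp add: algebra_simps)
  also have "\<dots> \<le> real m * ln 7"
  proof (rule mult_right_mono)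
    have "20 * r \<le> 3 * m" by (simp add: r_def)
    then show "real M + real (m - M) * (5 / 6) + real r \<le> real m"
      using M by (simp add: field_simps)
  qed simp
  finally show "sum ?f {1..m + 3 * m div 20} \<le> real m * ln 7" by (simp add: r_def)
qed

text \<open>The two ranges of good \<open>m\<close>, for \<open>F\<close> and for \<open>G\<close>, overlap and cover everything from \<open>K 3\<close> on.\<close>

lemma F_or_G_gains:
  assumes "K 3 \<le> m"
  shows "(\<exists>n. K (6 * n + 3) \<le> m \<and> m \<le> K (6 * n + 7)) \<or>
         (\<exists>n. K (6 * n + 6) \<le> m \<and> m \<le> K (6 * n + 10))"
proof -
  have "m < 10 ^ m" by (rule less_exp[THEN less_le_trans]) (simp add: power_mono)
  also have "\<dots> \<le> K m" unfolding K_def by (intro power_increasing) (auto intro: less_imp_le)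
  finally have "\<exists>p. m < K p" ..
  define p where "p = (LEAST p. m < K p)"
  have p: "m < K p" unfolding p_def using \<open>\<exists>p. m < K p\<close> by (rule LeastI_ex)
  then have "K 3 < K p" using assms by linarith
  then have "p > 3" by simp
  then have "\<not> m < K (p - 1)" unfolding p_def by (intro not_less_Least) simp
  then have q: "K (p - 1) \<le> m" by simp
  have "p = 6 * ((p - 4) div 6) + 4 + (p - 4) mod 6" using \<open>p > 3\<close> by presburger
  moreover have "(p - 4) mod 6 < 6" by simp
  ultimately obtain n d where nd: "p = 6 * n + 4 + d" "d < 6" by blast
  show ?thesis
  proof (cases "d \<le> 3")
    case True
    have "K (6 * n + 3) \<le> K (p - 1)" "K p \<le> K (6 * n + 7)" using nd True by auto
    then show ?thesis using p q by (meson less_imp_le order_trans)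
  next
    case False
    have "K (6 * n + 6) \<le> K (p - 1)" "K p \<le> K (6 * n + 10)" using nd False by auto
    then show ?thesis using p q by (meson less_imp_le order_trans)
  qed
qed

lemma covering_number_F_Times_G_ge:
  assumes "K 3 \<le> m" "0 < \<delta>" "\<delta> \<le> exp (- (real m * ln 7))"
  shows "2 ^ (2 * m + 3 * m div 20) \<le> covering_number (F_set \<times> G_set) \<delta>"
proof -
  note ge = covering_number_Times_cantor_like_ge[of "shifted_index 0" "shifted_index 3",
      OF shifted_index_bounds(1) shifted_index_bounds(1) \<open>0 < \<delta>\<close>,
      folded gen_index_F_eq gen_index_G_eq F_set_def G_set_def]
  have plain: "\<delta> \<le> stage_length (shifted_index s) m" for s
    using shifted_stage_length_ge assms(3) by (rule order_trans[rotated])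
  have exps: "m + 3 * m div 20 + m = 2 * m + 3 * m div 20"
    "m + (m + 3 * m div 20) = 2 * m + 3 * m div 20" by simp_all
  consider n where "K (6 * n + 3) \<le> m" "m \<le> K (6 * n + 7)"
    | n where "K (6 * n + 6) \<le> m" "m \<le> K (6 * n + 10)"
    using F_or_G_gains[OF assms(1)] by blast
  then show ?thesis
  proof cases
    case 1
    then have "\<delta> \<le> stage_length gen_index_F (m + 3 * m div 20)"
      using order_trans[OF assms(3) shifted_stage_length_ge_gain[of n 0 m]]
      by (simp add: gen_index_F_eq)
    then show ?thesis
      using ge[of "m + 3 * m div 20" m] plain[of 3] exps by (simp only: gen_index_G_eq)
  next
    case 2
    then have "\<delta> \<le> stage_length gen_index_G (m + 3 * m div 20)"
      using order_trans[OF assms(3) shifted_stage_length_ge_gain[of n 3 m]]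
      by (simp add: gen_index_G_eq add.commute)
    then show ?thesis
      using ge[of m "m + 3 * m div 20"] plain[of 0] exps by (simp only: gen_index_F_eq)
  qed
qed

text \<open>For \<open>7 ^ m \<le> 1 / \<delta> < 7 ^ (m + 1)\<close> the ratio of logarithms is at least
  \<open>(2 * m + 3 / 20 * m - 1) / (m + 1)\<close> times \<open>ln 2 / ln 7\<close>, and the first factor
  is at least \<open>21 / 10\<close> once \<open>m \<ge> 62\<close>.\<close>

lemma lower_box_dim_F_Times_G_ge:
  "ereal (21 / 10 * (ln 2 / ln 7)) \<le> lower_box_dim (F_set \<times> G_set)"
  unfolding lower_box_dim_def
proof (rule Liminf_bounded)
  define e where "e = exp (- (real (K 3) * ln 7))"
  have "21 / 10 * (ln 2 / ln 7) \<le> ln (real (covering_number (F_set \<times> G_set) \<delta>)) / (- ln \<delta>)"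
    if "0 < \<delta>" "\<delta> < e" for \<delta>
  proof -
    let ?N = "covering_number (F_set \<times> G_set) \<delta>"
    define x where "x = - ln \<delta> / ln 7"
    define m where "m = nat \<lfloor>x\<rfloor>"
    have "ln \<delta> < ln e" using that by (subst ln_less_cancel_iff) (auto simp: e_def)
    then have K3: "real (K 3) < x" by (simp add: x_def e_def field_simps)
    then have m: "real m \<le> x" "x < real m + 1"
      unfolding m_def by linarith+
    define r where "r = 3 * m div 20"
    have "K 3 \<le> m" using K3 unfolding m_def by linarith
    then have "62 \<le> m" by (simp add: K_def)
    have "real m * ln 7 \<le> x * ln 7" using m by (intro mult_right_mono) auto
    then have "real m * ln 7 \<le> - ln \<delta>" by (simp add: x_def)
    then have "\<delta> \<le> exp (- (real m * ln 7))"
      using \<open>0 < \<delta>\<close> by (metis exp_le_cancel_iff exp_ln le_minus_iff)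
    then have "2 ^ (2 * m + r) \<le> ?N"
      using covering_number_F_Times_G_ge[of m \<delta>] \<open>K 3 \<le> m\<close> \<open>0 < \<delta>\<close> by (simp add: r_def)
    then have "(2::real) ^ (2 * m + r) \<le> real ?N"
      by (metis of_nat_le_iff of_nat_numeral of_nat_power)
    then have "ln ((2::real) ^ (2 * m + r)) \<le> ln (real ?N)"
      by (intro ln_mono) auto
    then have N: "real (2 * m + r) * ln 2 \<le> ln (real ?N)"
      by (subst (asm) ln_realpow) auto
    have "3 * m < 20 + 20 * r" by (simp add: r_def dividend_less_times_div)
    then have "42 * (m + 1) \<le> 20 * (2 * m + r)"
      using \<open>62 \<le> m\<close> unfolding distrib_left by linarith
    then have "42 * (real m + 1) \<le> 20 * real (2 * m + r)"
      by (metis (mono_tags) of_nat_1 of_nat_add of_nat_le_iff of_nat_mult of_nat_numeral)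
    then have "42 * x \<le> 20 * real (2 * m + r)" using m(2) by argo
    then have "21 / 10 * x \<le> real (2 * m + r)" by simp
    then have "21 / 10 * x * ln 2 \<le> real (2 * m + r) * ln 2"
      by (intro mult_right_mono) auto
    then have "21 / 10 * x * ln 2 \<le> ln (real ?N)" using N by linarith
    then have "21 / 10 * (ln 2 / ln 7) * (- ln \<delta>) \<le> ln (real ?N)"
      by (simp add: x_def field_simps)
    moreover have "0 < x" using K3 by linarith
    then have "0 < - ln \<delta>" by (simp add: x_def divide_less_0_iff)
    ultimately show ?thesis by (subst pos_le_divide_eq)
  qed
  moreover have "e > 0" by (simp add: e_def)
  ultimately show "\<forall>\<^sub>F \<delta> in at_right 0. ereal (21 / 10 * (ln 2 / ln 7)) \<le>
      ereal (ln (real (covering_number (F_set \<times> G_set) \<delta>)) / (- ln \<delta>))"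
    unfolding eventually_at_right_field ereal_less_eq(3) by blast
qed

theorem corollary3p12:
  shows "lower_box_dim (F_set \<times> G_set) > lower_box_dim F_set + lower_box_dim G_set"
proof -
  let ?d = "ln 2 / ln (7::real)"
  have "lower_box_dim F_set + lower_box_dim G_set \<le> ereal (100 / 99 * ?d) + ereal (100 / 99 * ?d)"
    unfolding F_set_def G_set_def gen_index_F_eq gen_index_G_eq
    by (intro add_mono lower_box_dim_shifted_le)
  also have "\<dots> < ereal (21 / 10 * ?d)"
  proof -
    have "0 < ?d" by simp
    then have "100 / 99 * ?d + 100 / 99 * ?d < 21 / 10 * ?d" by linarith
    then show ?thesis by (simp only: plus_ereal.simps less_ereal.simps)
  qed
  also have "\<dots> \<le> lower_box_dim (F_set \<times> G_set)" by (rule lower_box_dim_F_Times_G_ge)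
  finally show ?thesis .
qed

end
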